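(* Let $M$ be an ordered $\Gamma$-groupoid and let $\mu,\sigma$ be fuzzy left (resp. fuzzy right) ideals of $M$. Then $\mu\times\sigma$ is a fuzzy left (resp. fuzzy right) ideal of $M\times M$.
   Context: Let $M,\Gamma$ be nonempty sets. $M$ is a $\Gamma$-groupoid if there is a well-defined operation $M\times\Gamma\times M\to M$, $(a,\gamma,b)\mapsto a\gamma b$ (no associativity assumed). An ordered $\Gamma$-groupoid is a $\Gamma$-groupoid $M$ with a partial order $\le$ on $M$ such that $a\le b$ implies $a\gamma c\le b\gamma c$ and $c\gamma a\le c\gamma b$ for all $c\in M$, $\gamma\in\Gamma$. $M\times M$ is an ordered $\Gamma$-groupoid under $(a,b)\gamma(c,d):=(a\gamma c,b\gamma d)$ and the componentwise order: $(a,b)\le(c,d)$ iff $a\le c$ and $b\le d$. A fuzzy subset of an ordered $\Gamma$-groupoid $N$ is any mapping $\mu:N\to[0,1]$. It is a fuzzy left (resp. right) ideal of $N$ if (1) $\mu(x\gamma y)\ge\mu(y)$ (resp. $\mu(x\gamma y)\ge\mu(x)$) for all $x,y\in N$, $\gamma\in\Gamma$, and (2) $x\le y$ implies $\mu(x)\ge\mu(y)$. For fuzzy subsets $\mu,\sigma$ of $M$, $\mu\times\sigma$ is the fuzzy subset of $M\times M$ given by $(\mu\times\sigma)(x,y):=\min\{\mu(x),\sigma(y)\}$. *)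

theory Defs
  imports Complex_Main "HOL-Library.FuncSet"
begin

locale gamma_groupoid =
  fixes M :: "'a set" and \<Gamma> :: "'g set" and mul :: "'a \<Rightarrow> 'g \<Rightarrow> 'a \<Rightarrow> 'a"
  assumes carrier_nonempty: "M \<noteq> {}"
    and Gamma_nonempty: "\<Gamma> \<noteq> {}"
    and mul_closed: "\<lbrakk>a \<in> M; \<gamma> \<in> \<Gamma>; b \<in> M\<rbrakk> \<Longrightarrow> mul a \<gamma> b \<in> M"

text \<open>The order is the relation \<open>R\<close>: \<open>(a, b) \<in> R\<close> means \<open>a \<le> b\<close>. In particular
  \<open>partial_order_on M R\<close> includes \<open>R \<subseteq> M \<times> M\<close>.\<close>

locale ordered_gamma_groupoid = gamma_groupoid M \<Gamma> mul
  for M :: "'a set" and \<Gamma> :: "'g set" and mul :: "'a \<Rightarrow> 'g \<Rightarrow> 'a \<Rightarrow> 'a" +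
  fixes R :: "'a rel"
  assumes partial_order: "partial_order_on M R"
    and mul_mono_left: "\<lbrakk>(a, b) \<in> R; c \<in> M; \<gamma> \<in> \<Gamma>\<rbrakk> \<Longrightarrow> (mul a \<gamma> c, mul b \<gamma> c) \<in> R"
    and mul_mono_right: "\<lbrakk>(a, b) \<in> R; c \<in> M; \<gamma> \<in> \<Gamma>\<rbrakk> \<Longrightarrow> (mul c \<gamma> a, mul c \<gamma> b) \<in> R"

definition prod_mul ::
  "('a \<Rightarrow> 'g \<Rightarrow> 'a \<Rightarrow> 'a) \<Rightarrow> ('b \<Rightarrow> 'g \<Rightarrow> 'b \<Rightarrow> 'b) \<Rightarrow> 'a \<times> 'b \<Rightarrow> 'g \<Rightarrow> 'a \<times> 'b \<Rightarrow> 'a \<times> 'b"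
  where "prod_mul f g p \<gamma> q = (f (fst p) \<gamma> (fst q), g (snd p) \<gamma> (snd q))"

definition prod_rel :: "'a rel \<Rightarrow> 'b rel \<Rightarrow> ('a \<times> 'b) rel"
  where "prod_rel R S = {((a, b), (c, d)). (a, c) \<in> R \<and> (b, d) \<in> S}"

text \<open>Values outside the carrier are unconstrained.\<close>

definition fuzzy_subset :: "'a set \<Rightarrow> ('a \<Rightarrow> real) \<Rightarrow> bool"
  where "fuzzy_subset N \<mu> \<longleftrightarrow> \<mu> \<in> N \<rightarrow> {0..1}"

definition fuzzy_left_ideal ::
  "'a set \<Rightarrow> 'g set \<Rightarrow> ('a \<Rightarrow> 'g \<Rightarrow> 'a \<Rightarrow> 'a) \<Rightarrow> 'a rel \<Rightarrow> ('a \<Rightarrow> real) \<Rightarrow> bool"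
  where "fuzzy_left_ideal N \<Gamma> mul R \<mu> \<longleftrightarrow>
    fuzzy_subset N \<mu> \<and>
    (\<forall>x\<in>N. \<forall>y\<in>N. \<forall>\<gamma>\<in>\<Gamma>. \<mu> (mul x \<gamma> y) \<ge> \<mu> y) \<and>
    (\<forall>x\<in>N. \<forall>y\<in>N. (x, y) \<in> R \<longrightarrow> \<mu> x \<ge> \<mu> y)"

definition fuzzy_right_ideal ::
  "'a set \<Rightarrow> 'g set \<Rightarrow> ('a \<Rightarrow> 'g \<Rightarrow> 'a \<Rightarrow> 'a) \<Rightarrow> 'a rel \<Rightarrow> ('a \<Rightarrow> real) \<Rightarrow> bool"
  where "fuzzy_right_ideal N \<Gamma> mul R \<mu> \<longleftrightarrow>
    fuzzy_subset N \<mu> \<and>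
    (\<forall>x\<in>N. \<forall>y\<in>N. \<forall>\<gamma>\<in>\<Gamma>. \<mu> (mul x \<gamma> y) \<ge> \<mu> x) \<and>
    (\<forall>x\<in>N. \<forall>y\<in>N. (x, y) \<in> R \<longrightarrow> \<mu> x \<ge> \<mu> y)"

definition fuzzy_prod :: "('a \<Rightarrow> real) \<Rightarrow> ('b \<Rightarrow> real) \<Rightarrow> 'a \<times> 'b \<Rightarrow> real"
  where "fuzzy_prod \<mu> \<sigma> = (\<lambda>(x, y). min (\<mu> x) (\<sigma> y))"

lemma ordered_gamma_groupoid_prod:
  assumes "ordered_gamma_groupoid M \<Gamma> f R" and "ordered_gamma_groupoid N \<Gamma> g S"
  shows "ordered_gamma_groupoid (M \<times> N) \<Gamma> (prod_mul f g) (prod_rel R S)"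
proof -
  interpret A: ordered_gamma_groupoid M \<Gamma> f R by fact
  interpret B: ordered_gamma_groupoid N \<Gamma> g S by fact
  have po: "partial_order_on (M \<times> N) (prod_rel R S)"
    using A.partial_order B.partial_order
    unfolding partial_order_on_def preorder_on_def refl_on_def trans_def antisym_def prod_rel_def
    by (simp add: subset_iff) blast
  show ?thesis
  proof
    show "M \<times> N \<noteq> {}" using A.carrier_nonempty B.carrier_nonempty by blast
    show "\<Gamma> \<noteq> {}" by (rule A.Gamma_nonempty)
    show "partial_order_on (M \<times> N) (prod_rel R S)" by (rule po)
  qed (auto simp: prod_mul_def prod_rel_def A.mul_closed B.mul_closed
      A.mul_mono_left A.mul_mono_right B.mul_mono_left B.mul_mono_right)
qed

end

theory Submission
  imports Defs
begin

text \<open>Multiplication and order on pairs act coordinatewise, so each ideal condition at a pair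
  splits into one inequality for \<mu> and one for \<sigma>. Since \<open>min\<close> is monotone in
  both arguments, these combine into the inequality for \<open>fuzzy_prod\<close>.
  \<open>fuzzy_left_ideal_prod\<close> and \<open>fuzzy_right_ideal_prod\<close> carry this out,
  with possibly different carriers over the same \<Gamma>.\<close>

lemma fuzzy_subset_prod:
  assumes "fuzzy_subset M \<mu>" and "fuzzy_subset N \<sigma>"
  shows "fuzzy_subset (M \<times> N) (fuzzy_prod \<mu> \<sigma>)"
  using assms unfolding fuzzy_subset_def fuzzy_prod_def Pi_iff
  by (auto simp: min_def)

lemma fuzzy_left_ideal_prod:
  assumes "fuzzy_left_ideal M \<Gamma> f R \<mu>" and "fuzzy_left_ideal N \<Gamma> g S \<sigma>"
  shows "fuzzy_left_ideal (M \<times> N) \<Gamma> (prod_mul f g) (prod_rel R S) (fuzzy_prod \<mu> \<sigma>)"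
  using assms unfolding fuzzy_left_ideal_def
  \<comment> \<open>The first call keeps \<open>fuzzy_prod\<close> folded so that
    \<open>fuzzy_subset_prod\<close> matches; only the second unfolds it, leaving the inequalities
    between minima.\<close>
  by (auto simp: fuzzy_subset_prod) (auto simp: fuzzy_prod_def prod_mul_def prod_rel_def
      intro: min.mono min.coboundedI1 min.coboundedI2)

text \<open>The same argument, with the bound now coming from the left factor of each coordinate
  product.\<close>

lemma fuzzy_right_ideal_prod:
  assumes "fuzzy_right_ideal M \<Gamma> f R \<mu>" and "fuzzy_right_ideal N \<Gamma> g S \<sigma>"
  shows "fuzzy_right_ideal (M \<times> N) \<Gamma> (prod_mul f g) (prod_rel R S) (fuzzy_prod \<mu> \<sigma>)"
  using assms unfolding fuzzy_right_ideal_def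
  by (auto simp: fuzzy_subset_prod) (auto simp: fuzzy_prod_def prod_mul_def prod_rel_def
      intro: min.mono min.coboundedI1 min.coboundedI2)

theorem theorem11:
  fixes M :: "'a set" and \<Gamma> :: "'g set" and mul :: "'a \<Rightarrow> 'g \<Rightarrow> 'a \<Rightarrow> 'a" and R :: "'a rel"
    and \<mu> \<sigma> :: "'a \<Rightarrow> real"
  assumes "ordered_gamma_groupoid M \<Gamma> mul R"
  shows "(fuzzy_left_ideal M \<Gamma> mul R \<mu> \<and> fuzzy_left_ideal M \<Gamma> mul R \<sigma> \<longrightarrow>
            fuzzy_left_ideal (M \<times> M) \<Gamma> (prod_mul mul mul) (prod_rel R R) (fuzzy_prod \<mu> \<sigma>)) \<and>
         (fuzzy_right_ideal M \<Gamma> mul R \<mu> \<and> fuzzy_right_ideal M \<Gamma> mul R \<sigma> \<longrightarrow>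
            fuzzy_right_ideal (M \<times> M) \<Gamma> (prod_mul mul mul) (prod_rel R R) (fuzzy_prod \<mu> \<sigma>))"
  \<comment> \<open>Both claims are the case of two equal factors.\<close>
  by (blast intro: fuzzy_left_ideal_prod fuzzy_right_ideal_prod)

end
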